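(* Let $\boldsymbol Y\sim H=\mathrm{GP}(G)$ be a $d$-variate multivariate generalized Pareto (mgp) random vector, where $G$ is a multivariate extreme-value distribution with standard Gumbel margins, and let $\boldsymbol T$ be a $\boldsymbol T$-generator of $H$. If $\boldsymbol T$ has density $f_{\boldsymbol T}$ with respect to the measure $\upsilon$ defined in the context, then $\boldsymbol Y$ has density $h_{\boldsymbol Y}$ with respect to $\upsilon$ equal to $$h_{\boldsymbol Y}(\boldsymbol y)=\mathbb 1\{\max(\boldsymbol y)>0\}\,e^{-\max(\boldsymbol y)}\int_{r\in\mathbb R} f_{\boldsymbol T}(r+\boldsymbol y)\,\mathrm dr .$$
   Context: $D=\{1,\dots,d\}$; vector operations are componentwise; $e^{-\infty}=0$ and $r+(-\infty)=-\infty$; $\boldsymbol x\not\le\boldsymbol 1$ means $x_j>1$ for some $j$. $G$ is a multivariate extreme-value distribution with Gumbel margins $G_j(x)=\exp(-e^{-x})$, and $G^*(\boldsymbol x)=G(\ln x_1,\dots,\ln x_d)$ is its version with unit-Fréchet margins. Its exponent measure $\mu$ is the Borel measure on $\mathbb E=[0,\infty)^d\setminus\{\boldsymbol 0\}$ with $G^*(\boldsymbol x)=\exp\{-\mu(\mathbb E\setminus[\boldsymbol 0,\boldsymbol x])\}$, and its stable tail dependence function is $\ell(\boldsymbol x)=-\ln G^*(1/\boldsymbol x)$. The mgp distribution $\mathrm{GP}(G)$ is the law of the random vector $\boldsymbol Y$ in $[-\infty,\infty)^d$ with $$\mathsf P[e^{\boldsymbol Y}\in B]=\frac{\mu(B\cap\{\boldsymbol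 x\ge\boldsymbol 0:\boldsymbol x\not\le\boldsymbol 1\})}{\mu(\{\boldsymbol x\ge\boldsymbol 0:\boldsymbol x\not\le\boldsymbol 1\})},\quad B\subseteq[\boldsymbol 0,\boldsymbol\infty)\text{ Borel}.$$ The spectral random vector $\boldsymbol S$ of $H$ takes values in $[-\infty,0]^d$, with $\mathsf P[\max(\boldsymbol S)=0]=1$, $\mathsf P[S_j>-\infty]>0$ for all $j$, $\mathsf E[e^{S_1}]=\dots=\mathsf E[e^{S_d}]$, $\ell(\boldsymbol y)=\mathsf E[\max(\boldsymbol ye^{\boldsymbol S})]/\mathsf E[e^{S_1}]$ for $\boldsymbol y\in[0,\infty)^d$; one has $\boldsymbol Y\overset{d}{=}E+\boldsymbol S$ with $E$ unit exponential independent of $\boldsymbol S$. A $\boldsymbol T$-generator of $H$ is a random vector $\boldsymbol T$ in $[-\infty,\infty)^d$ with $\mathsf P[\max(\boldsymbol T)>-\infty]=1$, $\mathsf P[T_j>-\infty]>0$ for all $j$, $\mathsf E[e^{T_1-\max(\boldsymbol T)}]=\dots=\mathsf E[e^{T_d-\max(\boldsymbol T)}]$ and $\boldsymbol S\overset{d}{=}\boldsymbol T-\max(\boldsymbol T)$. For non-empty $J\subseteq D$, $\mathbb A_J=\{\boldsymbol x\in[-\infty,\infty)^d: x_j>-\infty\text{ iff }j\in J\}$, $\pi_J:\mathbb A_J\to\mathbb R^J$ is $\boldsymbol x\mapsto(x_j)_{j\in J}$, $\lambda_m$ is $m$-dimensional Lebesgue measure, and $\upsilon$ is the measure on $[-\infty,\infty)^d$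 given by $\upsilon(\cdot)=\sum_{\emptyset\ne J\subseteq D}\lambda_{|J|}(\pi_J(\cdot\cap\mathbb A_J))$. *)

theory Defs
  imports "HOL-Probability.Probability"
begin

text \<open>
  The index set \<open>D\<close> is a finite type \<open>'n\<close>, so that \<open>d = CARD('n)\<close>. Points of \<open>\<real>\<^sup>d\<close> are functions
  \<open>'n \<Rightarrow> real\<close>, points of \<open>[-\<infinity>,\<infinity>)\<^sup>d\<close> are functions \<open>'n \<Rightarrow> ereal\<close> all of whose values are \<open>< \<infinity>\<close>;
  both function types carry the product topology and its Borel sigma-algebra.
\<close>

text \<open>Only arguments in \<open>[-\<infinity>,\<infinity>)\<close> are meaningful; the value at \<open>\<infinity>\<close> is arbitrary.\<close>

definition exp_ext :: "ereal \<Rightarrow> real" where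
  "exp_ext x = (if x = -\<infinity> then 0 else exp (real_of_ereal x))"

text \<open>The logarithm on \<open>[0,\<infinity>]\<close>, with \<open>ln 0 = -\<infinity>\<close> and \<open>ln \<infinity> = \<infinity>\<close>.\<close>

definition ln_ext :: "ereal \<Rightarrow> ereal" where
  "ln_ext x = (if x \<le> 0 then -\<infinity> else if x = \<infinity> then \<infinity> else ereal (ln (real_of_ereal x)))"

definition max_coord :: "('n::finite \<Rightarrow> 'a::linorder) \<Rightarrow> 'a" where
  "max_coord x = Max (range x)"


subsection \<open>Multivariate extreme-value distributions\<close>

text \<open>
  A distribution on \<open>\<real>\<^sup>d\<close> is a Borel probability measure; its distribution function is extended to
  \<open>[-\<infinity>,\<infinity>]\<^sup>d\<close>, so that an argument \<open>\<infinity>\<close> marginalises the corresponding coordinate.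
\<close>

definition df :: "('n::finite \<Rightarrow> real) measure \<Rightarrow> ('n \<Rightarrow> ereal) \<Rightarrow> real" where
  "df G x = measure G {z. \<forall>j. ereal (z j) \<le> x j}"

definition rdf :: "('n::finite \<Rightarrow> real) measure \<Rightarrow> ('n \<Rightarrow> real) \<Rightarrow> real" where
  "rdf G x = df G (\<lambda>j. ereal (x j))"

definition borel_prob :: "('n::finite \<Rightarrow> real) measure \<Rightarrow> bool" where
  "borel_prob G \<longleftrightarrow> prob_space G \<and> sets G = sets borel"

text \<open>
  Weak limits, with non-degenerate margins, of affinely normalised componentwise maxima of
  independent random vectors with a common distribution \<open>F\<close>: the maximum of \<open>n\<close> of them has
  distribution function \<open>F\<^sup>n\<close>.
\<close>

definition mev_distribution :: "('n::finite \<Rightarrow> real) measure \<Rightarrow> bool" where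
  "mev_distribution G \<longleftrightarrow>
     borel_prob G \<and>
     (\<forall>j. \<not> (\<exists>c. measure G {z. z j = c} = 1)) \<and>
     (\<exists>F a b. borel_prob F \<and> (\<forall>n j. a n j > 0) \<and>
        (\<forall>x. continuous (at x) (rdf G) \<longrightarrow>
           (\<lambda>n. rdf F (\<lambda>j. a n j * x j + b n j) ^ n) \<longlonglongrightarrow> rdf G x))"

definition gumbel_margins :: "('n::finite \<Rightarrow> real) measure \<Rightarrow> bool" where
  "gumbel_margins G \<longleftrightarrow> (\<forall>j x. measure G {z. z j \<le> x} = exp (- exp (- x)))"

definition frechet_df :: "('n::finite \<Rightarrow> real) measure \<Rightarrow> ('n \<Rightarrow> ereal) \<Rightarrow> real" where
  "frechet_df G x = df G (\<lambda>j. ln_ext (x j))"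

text \<open>Here \<open>1 / 0 = \<infinity>\<close>, as \<open>/\<close> is division of extended reals.\<close>

definition stdf :: "('n::finite \<Rightarrow> real) measure \<Rightarrow> ('n \<Rightarrow> real) \<Rightarrow> real" where
  "stdf G x = - ln (frechet_df G (\<lambda>j. 1 / ereal (x j)))"

definition exp_meas_space :: "('n::finite \<Rightarrow> real) set" where
  "exp_meas_space = {x. \<forall>j. 0 \<le> x j} - {\<lambda>_. 0}"

definition exponent_measure :: "('n::finite \<Rightarrow> real) measure \<Rightarrow> ('n \<Rightarrow> real) measure \<Rightarrow> bool" where
  "exponent_measure G \<mu> \<longleftrightarrow>
     space \<mu> = exp_meas_space \<and>
     sets \<mu> = sets (restrict_space borel exp_meas_space) \<and>
     (\<forall>x. (\<forall>j. 0 \<le> x j) \<longrightarrow>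
        frechet_df G (\<lambda>j. ereal (x j)) =
          exp_ext (- enn2ereal (emeasure \<mu> (exp_meas_space - {z. \<forall>j. 0 \<le> z j \<and> z j \<le> x j}))))"


subsection \<open>Multivariate generalized Pareto distributions\<close>

definition ext_space :: "('n::finite \<Rightarrow> ereal) set" where
  "ext_space = {x. \<forall>j. x j < \<infinity>}"

definition ext_borel :: "('n::finite \<Rightarrow> ereal) measure" where
  "ext_borel = restrict_space borel ext_space"

definition exceed :: "('n::finite \<Rightarrow> real) set" where
  "exceed = {x. (\<forall>j. 0 \<le> x j) \<and> \<not> (\<forall>j. x j \<le> 1)}"

text \<open>\<open>H = GP(G)\<close>, for a probability law \<open>H\<close> on \<open>[-\<infinity>,\<infinity>)\<^sup>d\<close>.\<close>

definition is_GP :: "('n::finite \<Rightarrow> real) measure \<Rightarrow> ('n \<Rightarrow> ereal) measure \<Rightarrow> bool" where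
  "is_GP G H \<longleftrightarrow>
     prob_space H \<and> sets H = sets ext_borel \<and>
     (\<exists>\<mu>. exponent_measure G \<mu> \<and>
        (\<forall>B\<in>sets borel. B \<subseteq> {x. \<forall>j. 0 \<le> x j} \<longrightarrow>
           emeasure H {y \<in> space H. (\<lambda>j. exp_ext (y j)) \<in> B} =
             emeasure \<mu> (B \<inter> exceed) / emeasure \<mu> exceed))"

text \<open>\<open>S\<close>, defined on the probability space \<open>M\<close>, is a spectral random vector of \<open>GP(G)\<close>.\<close>

definition spectral_vector ::
  "('n::finite \<Rightarrow> real) measure \<Rightarrow> 'a measure \<Rightarrow> ('a \<Rightarrow> 'n \<Rightarrow> ereal) \<Rightarrow> bool" where
  "spectral_vector G M S \<longleftrightarrow>
     prob_space M \<and> S \<in> measurable M (restrict_space borel {x. \<forall>j. x j \<le> 0}) \<and>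
     (AE \<omega> in M. max_coord (S \<omega>) = 0) \<and>
     (\<forall>j. measure M {\<omega> \<in> space M. S \<omega> j > -\<infinity>} > 0) \<and>
     (\<forall>i j. (\<integral>\<omega>. exp_ext (S \<omega> i) \<partial>M) = (\<integral>\<omega>. exp_ext (S \<omega> j) \<partial>M)) \<and>
     (\<forall>y j. (\<forall>i. 0 \<le> y i) \<longrightarrow>
        stdf G y = (\<integral>\<omega>. max_coord (\<lambda>i. y i * exp_ext (S \<omega> i)) \<partial>M) / (\<integral>\<omega>. exp_ext (S \<omega> j) \<partial>M))"

text \<open>
  \<open>T\<close>, defined on the probability space \<open>M\<close>, is a \<open>T\<close>-generator of \<open>GP(G)\<close>. As only the law of the
  spectral random vector matters, it may be taken on a probability space over \<open>'n \<Rightarrow> ereal\<close>. The laws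
  of \<open>S\<close> and \<open>T - max(T)\<close> are compared on all of \<open>[-\<infinity>,\<infinity>]\<^sup>d\<close>, because on the null event
  \<open>max(T) = -\<infinity>\<close> the difference \<open>-\<infinity> - (-\<infinity>)\<close> of extended reals is \<open>\<infinity>\<close>.
\<close>

definition T_generator ::
  "('n::finite \<Rightarrow> real) measure \<Rightarrow> 'a measure \<Rightarrow> ('a \<Rightarrow> 'n \<Rightarrow> ereal) \<Rightarrow> bool" where
  "T_generator G M T \<longleftrightarrow>
     prob_space M \<and> T \<in> measurable M ext_borel \<and>
     (AE \<omega> in M. max_coord (T \<omega>) > -\<infinity>) \<and>
     (\<forall>j. measure M {\<omega> \<in> space M. T \<omega> j > -\<infinity>} > 0) \<and>
     (\<forall>i j. (\<integral>\<omega>. exp_ext (T \<omega> i - max_coord (T \<omega>)) \<partial>M) =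
            (\<integral>\<omega>. exp_ext (T \<omega> j - max_coord (T \<omega>)) \<partial>M)) \<and>
     (\<exists>(N :: ('n \<Rightarrow> ereal) measure) S. spectral_vector G N S \<and>
        distr N borel S = distr M borel (\<lambda>\<omega> j. T \<omega> j - max_coord (T \<omega>)))"


subsection \<open>The dominating measure\<close>

definition face :: "'n set \<Rightarrow> ('n::finite \<Rightarrow> ereal) set" where
  "face J = {x \<in> ext_space. \<forall>j. x j > -\<infinity> \<longleftrightarrow> j \<in> J}"

text \<open>Elements of \<open>\<real>\<^sup>J\<close> are functions that are \<open>undefined\<close> outside \<open>J\<close>, as in \<open>Pi\<^sub>M J (\<lambda>_. lborel)\<close>.\<close>

definition face_proj :: "'n set \<Rightarrow> ('n::finite \<Rightarrow> ereal) \<Rightarrow> 'n \<Rightarrow> real" where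
  "face_proj J x = (\<lambda>j\<in>J. real_of_ereal (x j))"

definition upsilon :: "('n::finite \<Rightarrow> ereal) measure" where
  "upsilon = measure_of ext_space (sets ext_borel)
     (\<lambda>B. \<Sum>J | J \<noteq> {}. emeasure (\<Pi>\<^sub>M j\<in>J. lborel) (face_proj J ` (B \<inter> face J)))"

lemma space_ext_borel: "space ext_borel = ext_space"
  by (simp add: ext_borel_def space_restrict_space)

lemma ext_borel_closed: "sets ext_borel \<subseteq> Pow ext_space"
  using sets.space_closed[of ext_borel] unfolding space_ext_borel .

lemma space_upsilon: "space upsilon = ext_space"
  unfolding upsilon_def by (rule space_measure_of[OF ext_borel_closed])

lemma sets_upsilon: "sets upsilon = sets ext_borel"
  unfolding upsilon_def sets_measure_of[OF ext_borel_closed]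
  using sets.sigma_sets_eq[of ext_borel] unfolding space_ext_borel .

definition face_emb :: "'n set \<Rightarrow> ('n::finite \<Rightarrow> real) \<Rightarrow> 'n \<Rightarrow> ereal" where
  "face_emb J x = (\<lambda>j. if j \<in> J then ereal (x j) else -\<infinity>)"

lemma face_emb_measurable: "face_emb J \<in> measurable (\<Pi>\<^sub>M j\<in>J. lborel) ext_borel"
proof -
  have "(\<lambda>x. face_emb J x j) \<in> measurable (\<Pi>\<^sub>M j\<in>J. lborel) borel" for j
    unfolding face_emb_def by (cases "j \<in> J") auto
  then have "face_emb J \<in> measurable (\<Pi>\<^sub>M j\<in>J. lborel) borel"
    by (intro measurable_coordinatewise_then_product)
  then show ?thesis
    unfolding ext_borel_def
    by (rule measurable_restrict_space2[rotated]) (auto simp: ext_space_def face_emb_def)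
qed

lemma face_proj_image:
  "face_proj J ` (B \<inter> face J) = face_emb J -` B \<inter> space (\<Pi>\<^sub>M j\<in>J. lborel)"
proof (intro set_eqI iffI)
  fix z assume "z \<in> face_proj J ` (B \<inter> face J)"
  then obtain x where x: "x \<in> B" "x \<in> face J" "z = face_proj J x" by auto
  have "face_emb J z = x"
  proof
    fix j
    have "x j < \<infinity>" "x j > -\<infinity> \<longleftrightarrow> j \<in> J"
      using x(2) by (auto simp: face_def ext_space_def)
    then show "face_emb J z j = x j"
      by (cases "x j") (auto simp: x(3) face_emb_def face_proj_def)
  qed
  then show "z \<in> face_emb J -` B \<inter> space (\<Pi>\<^sub>M j\<in>J. lborel)"
    using x by (auto simp: space_PiM face_proj_def)
next
  fix z assume z: "z \<in> face_emb J -` B \<inter> space (\<Pi>\<^sub>M j\<in>J. lborel)"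
  then have "face_proj J (face_emb J z) = z"
    by (auto simp: face_proj_def face_emb_def space_PiM PiE_def extensional_def)
  moreover have "face_emb J z \<in> B \<inter> face J"
    using z by (auto simp: face_def ext_space_def face_emb_def)
  ultimately show "z \<in> face_proj J ` (B \<inter> face J)"
    by (metis image_eqI)
qed

lemma emeasure_upsilon:
  fixes B :: "('n::finite \<Rightarrow> ereal) set"
  assumes "B \<in> sets ext_borel"
  shows "emeasure upsilon B =
    (\<Sum>J | J \<noteq> {}. emeasure (\<Pi>\<^sub>M j\<in>J. lborel) (face_proj J ` (B \<inter> face J)))"
proof (rule emeasure_measure_of[OF upsilon_def])
  let ?m = "\<lambda>B :: ('n \<Rightarrow> ereal) set. \<Sum>J | J \<noteq> {}. emeasure (\<Pi>\<^sub>M j\<in>J. lborel) (face_proj J ` (B \<inter> face J))"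
  have m: "?m A = (\<Sum>J | J \<noteq> {}. emeasure (distr (\<Pi>\<^sub>M j\<in>J. lborel) ext_borel (face_emb J)) A)"
    if "A \<in> sets ext_borel" for A :: "('n \<Rightarrow> ereal) set"
    using that by (simp add: face_proj_image emeasure_distr face_emb_measurable)
  show "sets ext_borel \<subseteq> Pow (ext_space :: ('n \<Rightarrow> ereal) set)" by (rule ext_borel_closed)
  show "B \<in> sets upsilon" using assms by (simp add: sets_upsilon)
  show "positive (sets upsilon) ?m" by (simp add: positive_def)
  show "countably_additive (sets upsilon) ?m"
  proof (rule countably_additiveI)
    fix A :: "nat \<Rightarrow> ('n \<Rightarrow> ereal) set"
    assume A: "range A \<subseteq> sets upsilon" "disjoint_family A" "(\<Union>i. A i) \<in> sets upsilon"
    then have A': "A i \<in> sets ext_borel" "(\<Union>i. A i) \<in> sets ext_borel" for i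
      by (auto simp: sets_upsilon)
    have r: "range A \<subseteq> sets (distr (\<Pi>\<^sub>M j\<in>J. lborel) ext_borel (face_emb J))" for J :: "'n set"
      using A' by auto
    show "(\<Sum>i. ?m (A i)) = ?m (\<Union>i. A i)"
      unfolding m[OF A'(1)] m[OF A'(2)]
      by (subst suminf_sum) (auto intro!: sum.cong suminf_emeasure[OF r A(2)])
  qed
qed

end

theory Submission
  imports Defs
begin

text \<open>
  Put \<open>\<Phi>\<^sub>t(s) = max\<^sub>j exp(s\<^sub>j - t\<^sub>j)\<close> (\<open>profile t s\<close> below). The exponent measure of the complement of \<open>[0, e\<^sup>t]\<close> is
  \<open>E[\<Phi>\<^sub>t(S)] / E[exp S\<^sub>1]\<close>, so that
  \<open>P[Y \<le> t] = E[\<Phi>\<^bsub>min(t,0)\<^esub>(S) - \<Phi>\<^sub>t(S)] = E[max(1, \<Phi>\<^sub>t(S)) - \<Phi>\<^sub>t(S)]\<close> for real \<open>t\<close>,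
  using \<open>max S = 0\<close>. On the other hand, \<open>\<upsilon>\<close> is invariant under translation along the diagonal, and
  integrating the claimed density over \<open>{y \<le> t}\<close> by Tonelli's theorem gives
  \<open>E[\<integral> 1{\<Phi>\<^sub>t(T) \<le> e\<^sup>r, r < max T} exp(r - max T) dr]\<close>, whose inner integral is
  \<open>max(1, \<Phi>\<^sub>t(S)) - \<Phi>\<^sub>t(S)\<close> for \<open>S = T - max T\<close>. Lower sets with real corners determine the law.
\<close>

section \<open>Measurability and exhaustion of the extended space\<close>

definition translate :: "real \<Rightarrow> ('n::finite \<Rightarrow> ereal) \<Rightarrow> 'n \<Rightarrow> ereal" where
  "translate r y = (\<lambda>j. ereal r + y j)"

definition lower_set :: "('n::finite \<Rightarrow> real) \<Rightarrow> ('n \<Rightarrow> ereal) set" where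
  "lower_set t = {y \<in> ext_space. \<forall>j. y j \<le> ereal (t j)}"

lemma measurable_ext_borel_iff:
  "f \<in> measurable M ext_borel \<longleftrightarrow>
    (\<forall>j. (\<lambda>x. f x j) \<in> borel_measurable M) \<and> f \<in> space M \<rightarrow> ext_space"
proof -
  have "f \<in> borel_measurable M \<longleftrightarrow> (\<forall>j. (\<lambda>x. f x j) \<in> borel_measurable M)"
    using measurable_coordinatewise_then_product[of f M]
      measurable_compose[OF _ measurable_product_coordinates, of f M] by blast
  then show ?thesis
    unfolding ext_borel_def measurable_restrict_space2_iff by simp
qed

lemma measurable_ext_borel_component [measurable (raw)]:
  "f \<in> measurable M ext_borel \<Longrightarrow> (\<lambda>x. f x j) \<in> borel_measurable M"
  by (simp add: measurable_ext_borel_iff)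

lemma measurable_exp_ext [measurable]: "exp_ext \<in> borel_measurable borel"
  unfolding exp_ext_def[abs_def] by measurable

lemma measurable_max_coord_ext_borel [measurable (raw)]:
  "f \<in> measurable M ext_borel \<Longrightarrow> (\<lambda>x. max_coord (f x)) \<in> borel_measurable M"
  unfolding max_coord_def by measurable

lemma measurable_upsilon_eq: "measurable M upsilon = measurable M ext_borel"
    "measurable upsilon M = measurable ext_borel M"
  by (rule measurable_cong_sets; simp add: sets_upsilon)+

text \<open>Joint measurability in the point and the shift is what exchanging the integrals over
  \<open>y\<close> and \<open>r\<close> requires.\<close>

lemma measurable_translate:
  "(\<lambda>(y, r). translate r y) \<in> measurable (ext_borel \<Otimes>\<^sub>M borel) ext_borel"
  unfolding measurable_ext_borel_iff
proof (intro conjI allI)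
  show "(\<lambda>(y, r). translate r y) \<in> space (ext_borel \<Otimes>\<^sub>M borel) \<rightarrow> ext_space"
    by (auto simp: translate_def space_pair_measure space_ext_borel ext_space_def)
  have [measurable]: "(\<lambda>y. y j) \<in> borel_measurable ext_borel" for j :: 'a
    using measurable_ext_borel_component[of id ext_borel j] by simp
  fix j :: 'a
  show "(\<lambda>x. (case x of (y, r) \<Rightarrow> translate r y) j) \<in> borel_measurable (ext_borel \<Otimes>\<^sub>M borel)"
    unfolding translate_def case_prod_beta by measurable
qed

lemma translate_measurable: "translate r \<in> measurable ext_borel ext_borel"
  using measurable_compose[OF measurable_Pair2'[of r borel ext_borel] measurable_translate] by simp

text \<open>The sum of the absolute values of all coordinates serves as a bound;
  \<open>real_of_ereal\<close> sends -\<infinity> to 0, so infinite coordinates do not enter it. The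
  bound exhausts the space by lower sets and by sets of finite
  \<open>upsilon\<close>-measure.\<close>

lemma ext_space_bounded:
  assumes "x \<in> ext_space"
  shows "\<exists>k :: nat. \<forall>j. (x j = -\<infinity> \<or> ereal (- real k) \<le> x j) \<and> x j \<le> ereal (real k)"
proof -
  obtain k :: nat where k: "(\<Sum>j\<in>UNIV. \<bar>real_of_ereal (x j)\<bar>) \<le> real k"
    using real_arch_simple by blast
  have *: "\<bar>real_of_ereal (x j)\<bar> \<le> real k" for j
  proof -
    have "\<bar>real_of_ereal (x j)\<bar> \<le> (\<Sum>j\<in>UNIV. \<bar>real_of_ereal (x j)\<bar>)"
      by (rule member_le_sum) (simp_all only: UNIV_I abs_ge_zero finite)
    then show ?thesis using k by (rule order_trans)
  qed
  have "x j < \<infinity>" for j using assms by (simp add: ext_space_def)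
  then have "(x j = -\<infinity> \<or> ereal (- real k) \<le> x j) \<and> x j \<le> ereal (real k)" for j
    using *[of j] by (cases "x j") (force simp: abs_le_iff minus_le_iff)+
  then show ?thesis by blast
qed

lemma mem_lower_set: "y \<in> lower_set t \<longleftrightarrow> y \<in> ext_space \<and> (\<forall>j. y j \<le> ereal (t j))"
  by (simp add: lower_set_def)

lemma Union_lower_set: "(\<Union>k :: nat. lower_set (\<lambda>_. real k)) = ext_space"
proof (intro set_eqI iffI)
  fix y :: "'a \<Rightarrow> ereal" assume y: "y \<in> ext_space"
  obtain k :: nat where "\<forall>j. (y j = -\<infinity> \<or> ereal (- real k) \<le> y j) \<and> y j \<le> ereal (real k)"
    using ext_space_bounded[OF y] ..
  then show "y \<in> (\<Union>k :: nat. lower_set (\<lambda>_. real k))"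
    using y unfolding UN_iff mem_lower_set by blast
qed (simp add: mem_lower_set)

section \<open>Translation invariance and sigma-finiteness of \<open>upsilon\<close>\<close>

lemma distr_PiM_lborel_translate:
  fixes J :: "'i set"
  assumes "finite J"
  shows "distr (\<Pi>\<^sub>M j\<in>J. lborel) (\<Pi>\<^sub>M j\<in>J. lborel) (\<lambda>x. \<lambda>j\<in>J. r + x j) = (\<Pi>\<^sub>M j\<in>J. (lborel :: real measure))"
proof -
  interpret product_sigma_finite "\<lambda>_ :: 'i. lborel :: real measure" ..
  have [measurable]: "(\<lambda>x. \<lambda>j\<in>J. r + x j) \<in> measurable (\<Pi>\<^sub>M j\<in>J. (lborel :: real measure)) (\<Pi>\<^sub>M j\<in>J. lborel)"
    by measurable
  show ?thesis
  \<comment> \<open>Boxes suffice: the preimage of a box is the box of the shifted sides, and each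
    side keeps its Lebesgue measure.\<close>
  proof (rule PiM_eqI[OF assms])
    fix A :: "'i \<Rightarrow> real set" assume "\<And>i. i \<in> J \<Longrightarrow> A i \<in> sets lborel"
    then have A [measurable]: "\<And>i. i \<in> J \<Longrightarrow> A i \<in> sets borel" by simp
    have "(\<lambda>x. \<lambda>j\<in>J. r + x j) -` Pi\<^sub>E J A \<inter> space (\<Pi>\<^sub>M j\<in>J. (lborel :: real measure))
        = (\<Pi>\<^sub>E j\<in>J. (+) r -` A j)"
      by (auto simp: space_PiM PiE_def Pi_def extensional_def)
    moreover have "(+) r -` A j \<in> sets borel" if "j \<in> J" for j
      using measurable_sets[of "(+) r" borel borel "A j"] A[OF that] by simp
    moreover have "emeasure lborel ((+) r -` A j) = emeasure lborel (A j)" if "j \<in> J" for j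
      using emeasure_distr[of "(+) r" lborel borel "A j"] A[OF that] lborel_distr_plus[of r] by simp
    ultimately show "emeasure (distr (\<Pi>\<^sub>M j\<in>J. lborel) (\<Pi>\<^sub>M j\<in>J. lborel) (\<lambda>x. \<lambda>j\<in>J. r + x j)) (Pi\<^sub>E J A)
        = (\<Prod>i\<in>J. emeasure lborel (A i))"
      using assms A by (subst emeasure_distr) (auto simp: emeasure_PiM intro!: sets_PiM_I_finite)
  qed simp
qed

text \<open>Since r + (-\<infinity>) = -\<infinity>, a diagonal translation maps each face to itself
  and acts there as a shift of all real coordinates by \<open>r\<close>, which preserves Lebesgue
  measure.\<close>

lemma distr_upsilon_translate:
  "distr upsilon upsilon (translate r) = (upsilon :: ('n::finite \<Rightarrow> ereal) measure)"
proof (rule measure_eqI)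
  show "sets (distr upsilon upsilon (translate r)) = sets upsilon" by simp
  fix B :: "('n \<Rightarrow> ereal) set" assume "B \<in> sets (distr upsilon upsilon (translate r))"
  then have B: "B \<in> sets ext_borel" by (simp add: sets_upsilon)
  have B': "translate r -` B \<inter> ext_space \<in> sets ext_borel"
    using measurable_sets[OF translate_measurable B] by (simp add: space_ext_borel)
  have "emeasure (\<Pi>\<^sub>M j\<in>J. lborel) (face_emb J -` (translate r -` B \<inter> ext_space) \<inter> space (\<Pi>\<^sub>M j\<in>J. lborel))
      = emeasure (\<Pi>\<^sub>M j\<in>J. lborel) (face_emb J -` B \<inter> space (\<Pi>\<^sub>M j\<in>J. lborel))" for J :: "'n set"
  proof -
    let ?P = "\<Pi>\<^sub>M j\<in>J. (lborel :: real measure)" and ?g = "\<lambda>x. \<lambda>j\<in>J. r + x j"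
    have "translate r (face_emb J x) = face_emb J (?g x)" for x
      by (auto simp: translate_def face_emb_def)
    then have "face_emb J -` (translate r -` B \<inter> ext_space) \<inter> space ?P
      = ?g -` (face_emb J -` B \<inter> space ?P) \<inter> space ?P"
      by (auto simp: space_PiM ext_space_def face_emb_def)
    moreover have "face_emb J -` B \<inter> space ?P \<in> sets ?P"
      by (rule measurable_sets[OF face_emb_measurable B])
    ultimately have "emeasure ?P (face_emb J -` (translate r -` B \<inter> ext_space) \<inter> space ?P)
      = emeasure (distr ?P ?P ?g) (face_emb J -` B \<inter> space ?P)"
      using emeasure_distr[of ?g ?P ?P "face_emb J -` B \<inter> space ?P"] by simp
    then show ?thesis by (simp add: distr_PiM_lborel_translate)
  qed
  then have "emeasure upsilon (translate r -` B \<inter> ext_space) = emeasure upsilon B"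
    unfolding emeasure_upsilon[OF B] emeasure_upsilon[OF B'] face_proj_image by simp
  then show "emeasure (distr upsilon upsilon (translate r)) B = emeasure upsilon B"
    using B translate_measurable[of r, folded measurable_upsilon_eq]
    by (subst emeasure_distr) (simp_all only: sets_upsilon space_upsilon)
qed

text \<open>The sets \<open>C k\<close> let every coordinate be either -\<infinity> or in [-k, k].
  Such a set meets each of the finitely many faces in a cube of finite volume.\<close>

lemma sigma_finite_upsilon: "sigma_finite_measure (upsilon :: ('n::finite \<Rightarrow> ereal) measure)"
proof
  define C where "C k = {x \<in> (ext_space :: ('n \<Rightarrow> ereal) set).
      \<forall>j. x j = -\<infinity> \<or> ereal (- real k) \<le> x j \<and> x j \<le> ereal (real k)}" for k :: nat
  have [measurable]: "(\<lambda>x. x j) \<in> borel_measurable ext_borel" for j :: 'n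
    using measurable_ext_borel_component[of id ext_borel j] by simp
  have C: "C k \<in> sets ext_borel" for k
  proof -
    have "{x \<in> space (ext_borel :: ('n \<Rightarrow> ereal) measure).
      \<forall>j. x j = -\<infinity> \<or> ereal (- real k) \<le> x j \<and> x j \<le> ereal (real k)} \<in> sets ext_borel"
      by measurable
    then show ?thesis unfolding C_def space_ext_borel .
  qed
  interpret product_sigma_finite "\<lambda>_ :: 'n. lborel :: real measure" ..
  have "emeasure upsilon (C k) < \<infinity>" for k
  proof -
    have "face_emb J -` C k \<inter> space (\<Pi>\<^sub>M j\<in>J. lborel) = (\<Pi>\<^sub>E j\<in>J. {- real k..real k})" for J :: "'n set"
      by (auto simp: C_def face_emb_def ext_space_def space_PiM PiE_def Pi_def split: if_splits)
    then show ?thesis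
      unfolding emeasure_upsilon[OF C] face_proj_image
      by (simp add: emeasure_PiM ennreal_power ennreal_less_top flip: ennreal_numeral)
  qed
  moreover have "(\<Union>k. C k) = ext_space"
  proof -
    have "\<exists>k. x \<in> C k" if x: "x \<in> ext_space" for x
    proof -
      obtain k :: nat where k: "\<forall>j. (x j = -\<infinity> \<or> ereal (- real k) \<le> x j) \<and> x j \<le> ereal (real k)"
        using ext_space_bounded[OF x] ..
      have "x \<in> C k" unfolding C_def using x k by blast
      then show ?thesis ..
    qed
    moreover have "C k \<subseteq> ext_space" for k unfolding C_def by blast
    ultimately show ?thesis by blast
  qed
  ultimately show "\<exists>A. countable A \<and> A \<subseteq> sets upsilon \<and> \<Union>A = space (upsilon :: ('n \<Rightarrow> ereal) measure)
      \<and> (\<forall>a\<in>A. emeasure upsilon a \<noteq> \<infinity>)"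
    using C by (intro exI[of _ "range C"]) (auto simp: space_upsilon sets_upsilon less_top[symmetric])
qed

section \<open>Lower sets with real corners determine a law\<close>

lemma lower_set_measurable: "lower_set t \<in> sets ext_borel"
proof -
  have [measurable]: "(\<lambda>x. x j) \<in> borel_measurable ext_borel" for j :: 'a
    using measurable_ext_borel_component[of id ext_borel j] by simp
  have "{y \<in> space ext_borel. \<forall>j. y j \<le> ereal (t j)} \<in> sets ext_borel"
    by measurable
  then show ?thesis unfolding lower_set_def space_ext_borel .
qed

lemma sets_ext_borel_lower_set:
  "sets (ext_borel :: ('n::finite \<Rightarrow> ereal) measure) = sigma_sets ext_space (range lower_set)"
proof
  let ?S = "sigma (ext_space :: ('n \<Rightarrow> ereal) set) (range lower_set)"
  have sub: "range lower_set \<subseteq> Pow (ext_space :: ('n \<Rightarrow> ereal) set)"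
    by (auto simp: lower_set_def)
  have space: "space ?S = ext_space" by (rule space_measure_of[OF sub])
  have sets: "sets ?S = sigma_sets ext_space (range lower_set)" by (rule sets_measure_of[OF sub])
  have lower [measurable]: "lower_set t \<in> sets ?S" for t by (auto simp: sets)
  have real_case: "{y \<in> space ?S. y j \<le> ereal a} \<in> sets ?S" for j :: 'n and a
  proof -
    \<comment> \<open>The other coordinates are released by letting their corner \<open>k\<close>
      grow; no coordinate equals \<infinity>, so the union is everything.\<close>
    have "{y \<in> space ?S. y j \<le> ereal a} = (\<Union>k :: nat. lower_set (\<lambda>i. if i = j then a else real k))"
    proof (intro set_eqI iffI)
      fix y assume y: "y \<in> {y \<in> space ?S. y j \<le> ereal a}"
      then have y': "y \<in> ext_space" by (simp only: space mem_Collect_eq)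
      obtain k :: nat where "\<forall>i. (y i = -\<infinity> \<or> ereal (- real k) \<le> y i) \<and> y i \<le> ereal (real k)"
        using ext_space_bounded[OF y'] ..
      then have "y \<in> lower_set (\<lambda>i. if i = j then a else real k)"
        using y y' unfolding mem_lower_set by simp
      then show "y \<in> (\<Union>k :: nat. lower_set (\<lambda>i. if i = j then a else real k))" by blast
    next
      fix y assume "y \<in> (\<Union>k :: nat. lower_set (\<lambda>i. if i = j then a else real k))"
      then obtain k :: nat where "y \<in> lower_set (\<lambda>i. if i = j then a else real k)" by blast
      then show "y \<in> {y \<in> space ?S. y j \<le> ereal a}"
        unfolding mem_lower_set space mem_Collect_eq by presburger
    qed
    then show ?thesis by simp
  qed
  have "(\<lambda>y. y j) \<in> borel_measurable ?S" for j :: 'n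
  proof (rule borel_measurableI_le)
    fix c :: ereal
    show "{y \<in> space ?S. y j \<le> c} \<in> sets ?S"
    proof (cases c)
      case PInf then show ?thesis by simp
    next
      case MInf
      \<comment> \<open>Corners are real, so the event that coordinate \<open>j\<close> equals
        -\<infinity> is reached only as a countable intersection.\<close>
      have "{y \<in> space ?S. y j \<le> c} = (\<Inter>k :: nat. {y \<in> space ?S. y j \<le> ereal (- real k)})"
      proof (intro set_eqI iffI)
        fix y assume y: "y \<in> (\<Inter>k :: nat. {y \<in> space ?S. y j \<le> ereal (- real k)})"
        have "y j = -\<infinity>"
        proof (rule ereal_bot)
          fix B :: real
          obtain k :: nat where "- B \<le> real k" using real_arch_simple by blast
          moreover have "y j \<le> ereal (- real k)" using y by auto
          ultimately show "y j \<le> ereal B" by (metis ereal_less_eq(3) minus_le_iff order_trans)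
        qed
        then show "y \<in> {y \<in> space ?S. y j \<le> c}" using y MInf by auto
      qed (use MInf in auto)
      then show ?thesis using real_case by simp
    qed (use real_case in simp)
  qed
  then have "(\<lambda>y. y) \<in> measurable ?S ext_borel"
    by (simp add: measurable_ext_borel_iff space)
  from measurable_sets[OF this]
  have "B \<in> sigma_sets ext_space (range lower_set)" if "B \<in> sets ext_borel" for B :: "('n \<Rightarrow> ereal) set"
    using that sets.sets_into_space[OF that] unfolding sets space
    by (force simp: space_ext_borel Int_absorb2)
  then show "sets (ext_borel :: ('n \<Rightarrow> ereal) measure) \<subseteq> sigma_sets ext_space (range lower_set)" by blast
  show "sigma_sets ext_space (range lower_set) \<subseteq> sets (ext_borel :: ('n \<Rightarrow> ereal) measure)"
    using sets.sigma_sets_subset[of "range lower_set" ext_borel] lower_set_measurable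
    by (auto simp: space_ext_borel)
qed

text \<open>Lower sets form a generating pi-system, two of them meeting in the lower set of the
  componentwise minimum of the corners. Finiteness of \<open>P\<close> gives finite values on an
  exhausting sequence.\<close>

lemma measure_eqI_lower_set:
  fixes P Q :: "('n::finite \<Rightarrow> ereal) measure"
  assumes "finite_measure P" "sets P = sets ext_borel" "sets Q = sets ext_borel"
    and "\<And>t. emeasure P (lower_set t) = emeasure Q (lower_set t)"
  shows "P = Q"
proof (rule measure_eqI_generator_eq[where E = "range lower_set" and \<Omega> = ext_space
      and A = "\<lambda>k :: nat. lower_set (\<lambda>_. real k)"])
  have "lower_set s \<inter> lower_set t = lower_set (\<lambda>j. min (s j) (t j))" for s t :: "'n \<Rightarrow> real"
  proof -
    have "x \<le> ereal (min a b) \<longleftrightarrow> x \<le> ereal a \<and> x \<le> ereal b" for x a b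
      by (cases x) auto
    then show ?thesis by (auto simp: lower_set_def)
  qed
  then show "Int_stable (range lower_set :: ('n \<Rightarrow> ereal) set set)"
    by (auto intro!: Int_stableI)
  show "range lower_set \<subseteq> Pow (ext_space :: ('n \<Rightarrow> ereal) set)"
    by (auto simp: lower_set_def)
  show "sets P = sigma_sets ext_space (range lower_set)" "sets Q = sigma_sets ext_space (range lower_set)"
    using assms sets_ext_borel_lower_set by auto
  show "(\<Union>k :: nat. lower_set (\<lambda>_. real k)) = (ext_space :: ('n \<Rightarrow> ereal) set)"
    by (rule Union_lower_set)
  show "emeasure P (lower_set (\<lambda>_. real k)) \<noteq> \<infinity>" for k :: nat
    using finite_measure.emeasure_finite[OF assms(1)] by simp
qed (use assms in auto)

section \<open>The exponential integral along a diagonal\<close>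

lemma translate_minus [simp]: "translate r (translate (- r) y) = y"
proof
  fix j show "translate r (translate (- r) y) j = y j"
    by (cases "y j") (simp_all add: translate_def)
qed

text \<open>For \<open>u \<le> 1\<close> the window is the interval from \<open>ln u + m\<close> to
  \<open>m\<close>, over which the antiderivative \<open>exp (r - m)\<close> grows from
  \<open>u\<close> to 1. For \<open>u > 1\<close> the window is empty and both sides vanish.\<close>

lemma nn_integral_exp_window:
  fixes m u :: real
  assumes "0 < u"
  shows "(\<integral>\<^sup>+ r. indicator {r. u \<le> exp (r - m) \<and> r < m} r * ennreal (exp (r - m)) \<partial>lborel)
    = ennreal (max 1 u - u)"
proof (cases "u \<le> 1")
  case True
  define a where "a = ln u + m"
  have "u \<le> exp (r - m) \<longleftrightarrow> a \<le> r" for r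
    using assms ln_le_cancel_iff[of u "exp (r - m)"] by (auto simp: a_def)
  then have "indicator {r. u \<le> exp (r - m) \<and> r < m} r * ennreal (exp (r - m))
      = ennreal (exp (r - m)) * indicator {a..m} r" if "r \<noteq> m" for r
    using that by (simp add: indicator_def order_less_le)
  \<comment> \<open>The window is open at \<open>m\<close>; closing it changes the integrand only at
    the null point \<open>r = m\<close>.\<close>
  then have "AE r in lborel. indicator {r. u \<le> exp (r - m) \<and> r < m} r * ennreal (exp (r - m))
      = ennreal (exp (r - m)) * indicator {a..m} r"
    using AE_lborel_singleton[of m] by (rule eventually_mono[rotated])
  then have "(\<integral>\<^sup>+ r. indicator {r. u \<le> exp (r - m) \<and> r < m} r * ennreal (exp (r - m)) \<partial>lborel)
    = (\<integral>\<^sup>+ r. ennreal (exp (r - m)) * indicator {a..m} r \<partial>lborel)"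
    by (rule nn_integral_cong_AE)
  also have "\<dots> = ennreal (exp (m - m) - exp (a - m))"
    using True assms
    by (intro nn_integral_FTC_Icc) (auto simp: a_def intro!: derivative_eq_intros)
  finally show ?thesis using assms True by (simp add: a_def max_def)
next
  case False
  have "u \<le> exp (r - m) \<Longrightarrow> \<not> r < m" for r
  proof
    assume "u \<le> exp (r - m)" "r < m"
    then have "exp (r - m) < 1" by simp
    with \<open>u \<le> exp (r - m)\<close> False show False by linarith
  qed
  then show ?thesis using False by (simp add: indicator_def max_def cong: conj_cong)
qed

text \<open>The product form, rather than the exponential of a difference, matches the integrand of
  the stable tail dependence function at the point with coordinates \<open>exp (- t i)\<close>;
  coordinates equal to -\<infinity> contribute 0.\<close>

definition profile :: "('n::finite \<Rightarrow> real) \<Rightarrow> ('n \<Rightarrow> ereal) \<Rightarrow> real" where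
  "profile t s = max_coord (\<lambda>i. exp (- t i) * exp_ext (s i))"

lemma measurable_profile [measurable]: "profile t \<in> borel_measurable borel"
proof -
  have "(\<lambda>s. Max ((\<lambda>i. exp (- t i) * exp_ext (s i)) ` UNIV)) \<in> borel_measurable borel"
    by measurable
  then show ?thesis unfolding profile_def[abs_def] max_coord_def .
qed

section \<open>A point \<open>z\<close> with finite maximum, as a typical value of \<open>T\<close>,
  recentred at that maximum\<close>

context
  fixes z :: "'n::finite \<Rightarrow> ereal" and m :: real
  assumes m: "max_coord z = ereal m"
begin

lemma coord_le: "z j \<le> ereal m"
  unfolding m[symmetric] max_coord_def by simp

lemma coord_attains: "\<exists>j. z j = ereal m"
proof -
  have "max_coord z \<in> range z" unfolding max_coord_def by (rule Max_in) auto
  then show ?thesis unfolding m by (metis imageE)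
qed

lemma exp_ext_recentre: "exp_ext (z j - max_coord z) = (if z j = -\<infinity> then 0 else exp (real_of_ereal (z j) - m))"
  using coord_le[of j] unfolding m by (cases "z j") (auto simp: exp_ext_def)

lemma exp_ext_recentre_le_1: "exp_ext (z j - max_coord z) \<le> 1"
  using coord_le[of j] unfolding exp_ext_recentre by (cases "z j") auto

lemma profile_le_iff: "profile t (\<lambda>j. z j - max_coord z) \<le> c \<longleftrightarrow>
    (\<forall>j. exp (- t j) * exp_ext (z j - max_coord z) \<le> c)"
  unfolding profile_def max_coord_def[of "\<lambda>i. exp (- t i) * _ i"] by (subst Max_le_iff) auto

text \<open>A coordinate attaining the maximum contributes \<open>exp (- t j)\<close>.\<close>

lemma profile_pos: "0 < profile t (\<lambda>j. z j - max_coord z)"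
proof -
  obtain j where "z j = ereal m" using coord_attains ..
  then have "0 < exp (- t j) * exp_ext (z j - max_coord z)" unfolding exp_ext_recentre by simp
  also have "\<dots> \<le> profile t (\<lambda>j. z j - max_coord z)"
    using profile_le_iff[of t "profile t (\<lambda>j. z j - max_coord z)"] by simp
  finally show ?thesis .
qed

text \<open>As \<open>exp (- min (t j) 0)\<close> is the larger of 1 and \<open>exp (- t j)\<close>,
  the left side is the larger of the greatest recentred exponential, which is 1, and the profile at
  \<open>t\<close>.\<close>

lemma profile_min_zero: "profile (\<lambda>j. min (t j) 0) (\<lambda>j. z j - max_coord z)
    = max 1 (profile t (\<lambda>j. z j - max_coord z))"
proof -
  \<comment> \<open>Both sides are compared through their upper bounds \<open>c\<close>, which turns
    the maxima into conjunctions.\<close>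
  have *: "profile (\<lambda>j. min (t j) 0) (\<lambda>j. z j - max_coord z) \<le> c \<longleftrightarrow>
      1 \<le> c \<and> profile t (\<lambda>j. z j - max_coord z) \<le> c" for c
  proof -
    obtain k where k: "z k = ereal m" using coord_attains ..
    have "exp (- min (t j) 0) * e \<le> c \<longleftrightarrow> e \<le> c \<and> exp (- t j) * e \<le> c" if "0 \<le> e" for j e
    proof -
      have "exp (- min (t j) 0) = max 1 (exp (- t j))" by (simp add: min_def max_def)
      moreover have "e \<le> exp (- t j) * e" if "1 \<le> exp (- t j)"
        using mult_right_mono[OF that \<open>0 \<le> e\<close>] by simp
      moreover have "exp (- t j) * e \<le> e" if "exp (- t j) \<le> 1"
        using mult_right_mono[OF that \<open>0 \<le> e\<close>] by simp
      ultimately show ?thesis by (cases "1 \<le> exp (- t j)") (auto simp: max_def simp del: one_le_exp_iff exp_le_one_iff)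
    qed
    moreover have "0 \<le> exp_ext (z j - max_coord z)" for j by (simp add: exp_ext_recentre)
    moreover have "(\<forall>j. exp_ext (z j - max_coord z) \<le> c) \<longleftrightarrow> 1 \<le> c"
    proof
      assume "\<forall>j. exp_ext (z j - max_coord z) \<le> c"
      from spec[OF this, of k] show "1 \<le> c" unfolding exp_ext_recentre by (simp add: k)
    qed (use exp_ext_recentre_le_1 order_trans in blast)
    ultimately show ?thesis by (simp add: profile_le_iff all_conj_distrib)
  qed
  show ?thesis
  proof (rule order_antisym)
    show "profile (\<lambda>j. min (t j) 0) (\<lambda>j. z j - max_coord z)
        \<le> max 1 (profile t (\<lambda>j. z j - max_coord z))"
      unfolding * by simp
    show "max 1 (profile t (\<lambda>j. z j - max_coord z))
        \<le> profile (\<lambda>j. min (t j) 0) (\<lambda>j. z j - max_coord z)"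
      using *[THEN iffD1, OF order_refl] by simp
  qed
qed

lemma max_coord_translate: "max_coord (translate r z) = ereal (r + m)"
  unfolding max_coord_def
proof (rule Max_eqI)
  obtain j where "z j = ereal m" using coord_attains ..
  then have "translate r z j = ereal (r + m)" by (simp add: translate_def)
  then show "ereal (r + m) \<in> range (translate r z)" by (metis rangeI)
  fix y assume "y \<in> range (translate r z)"
  then obtain j where "y = ereal r + z j" by (auto simp: translate_def)
  then show "y \<le> ereal (r + m)" using coord_le[of j] by (cases "z j") auto
qed simp

text \<open>For real coordinates, \<open>z j - r \<le> t j\<close> says
  \<open>z j - m - t j \<le> r - m\<close>; exponentiate. A coordinate -\<infinity> satisfies both
  sides, the right one as \<open>0 \<le> exp (r - m)\<close>.\<close>

lemma translate_mem_lower_set: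
  "translate (- r) z \<in> lower_set t \<longleftrightarrow> profile t (\<lambda>j. z j - max_coord z) \<le> exp (r - m)"
proof -
  have "translate (- r) z \<in> ext_space"
    unfolding ext_space_def mem_Collect_eq
  proof
    fix j show "translate (- r) z j < \<infinity>"
      using coord_le[of j] by (cases "z j") (auto simp: translate_def)
  qed
  moreover have "translate (- r) z j \<le> ereal (t j) \<longleftrightarrow>
      exp (- t j) * exp_ext (z j - max_coord z) \<le> exp (r - m)" for j
  proof (cases "z j")
    case (real x)
    have "exp (- t j) * exp_ext (z j - max_coord z) = exp (- t j + (x - m))"
      unfolding exp_ext_recentre by (simp only: exp_add) (simp add: real)
    then show ?thesis by (simp add: translate_def real) arith
  next
    case MInf
    then show ?thesis unfolding exp_ext_recentre by (simp add: translate_def)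
  qed (use coord_le[of j] in simp)
  ultimately show ?thesis by (simp add: mem_lower_set profile_le_iff)
qed

text \<open>The shifted point has maximum \<open>m - r\<close>: positivity of it means
  \<open>r < m\<close>, and the weight becomes \<open>exp (r - m)\<close>. The window integral
  applies with \<open>u\<close> the profile at \<open>t\<close>.\<close>

lemma nn_integral_translates:
  "(\<integral>\<^sup>+ r. indicator (lower_set t) (translate (- r) z) *
      (indicator {y. 0 < max_coord y} (translate (- r) z) *
        ennreal (exp_ext (- max_coord (translate (- r) z)))) \<partial>lborel)
    = ennreal (profile (\<lambda>j. min (t j) 0) (\<lambda>j. z j - max_coord z) - profile t (\<lambda>j. z j - max_coord z))"
  unfolding profile_min_zero nn_integral_exp_window[OF profile_pos, where m = m, symmetric]
  by (intro nn_integral_cong)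
    (auto simp: indicator_def translate_mem_lower_set max_coord_translate exp_ext_def)

end

section \<open>Exchanging the order of integration\<close>

lemma measurable_translate_upsilon [measurable (raw)]:
  fixes y :: "'b \<Rightarrow> 'n::finite \<Rightarrow> ereal"
  assumes "y \<in> measurable M upsilon" "r \<in> borel_measurable M"
  shows "(\<lambda>x. translate (r x) (y x)) \<in> measurable M upsilon"
proof -
  have "(\<lambda>(y, r). translate r y) \<in> measurable (upsilon \<Otimes>\<^sub>M lborel) (upsilon :: ('n \<Rightarrow> ereal) measure)"
    using measurable_translate[where 'a = 'n] unfolding measurable_upsilon_eq
      measurable_cong_sets[OF sets_pair_measure_cong[OF sets_upsilon sets_lborel] refl] .
  from measurable_compose[OF measurable_Pair[of y M upsilon r lborel] this] show ?thesis
    using assms by simp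
qed

text \<open>Tonelli's theorem brings the integral over \<open>r\<close> outside, the substitution of
  \<open>z\<close> for \<open>y\<close> shifted by \<open>r\<close> moves the shift from
  \<open>f\<close> onto the set and the weight, and Tonelli's theorem restores the order.\<close>

lemma emeasure_density_translates:
  fixes f w :: "('n::finite \<Rightarrow> ereal) \<Rightarrow> ennreal"
  assumes f: "f \<in> borel_measurable upsilon" and w: "w \<in> borel_measurable upsilon"
  shows "(\<lambda>y. w y * (\<integral>\<^sup>+ r. f (translate r y) \<partial>lborel)) \<in> borel_measurable upsilon"
    and "A \<in> sets ext_borel \<Longrightarrow>
      (\<lambda>z. \<integral>\<^sup>+ r. indicator A (translate (- r) z) * w (translate (- r) z) \<partial>lborel) \<in> borel_measurable upsilon"
    and "A \<in> sets ext_borel \<Longrightarrow> emeasure (density upsilon (\<lambda>y. w y * (\<integral>\<^sup>+ r. f (translate r y) \<partial>lborel))) A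
      = (\<integral>\<^sup>+ z. f z * (\<integral>\<^sup>+ r. indicator A (translate (- r) z) * w (translate (- r) z) \<partial>lborel) \<partial>upsilon)"
proof -
  interpret sigma_finite_measure "upsilon :: ('n \<Rightarrow> ereal) measure" by (rule sigma_finite_upsilon)
  interpret pair_sigma_finite "upsilon :: ('n \<Rightarrow> ereal) measure" "lborel :: real measure" ..
  note [measurable] = f w
  show mh: "(\<lambda>y. w y * (\<integral>\<^sup>+ r. f (translate r y) \<partial>lborel)) \<in> borel_measurable upsilon"
    by measurable
  assume "A \<in> sets ext_borel"
  then have A [measurable]: "A \<in> sets upsilon" by (simp add: sets_upsilon)
  show "(\<lambda>z. \<integral>\<^sup>+ r. indicator A (translate (- r) z) * w (translate (- r) z) \<partial>lborel) \<in> borel_measurable upsilon"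
    by measurable
  have "emeasure (density upsilon (\<lambda>y. w y * (\<integral>\<^sup>+ r. f (translate r y) \<partial>lborel))) A
    = (\<integral>\<^sup>+ y. (\<integral>\<^sup>+ r. f (translate r y) * (indicator A y * w y) \<partial>lborel) \<partial>upsilon)"
    by (subst emeasure_density[OF mh A])
      (auto intro!: nn_integral_cong simp: nn_integral_multc mult.commute mult.left_commute
        simp flip: nn_integral_cmult)
  also have "\<dots> = (\<integral>\<^sup>+ r. (\<integral>\<^sup>+ y. f (translate r y) * (indicator A y * w y) \<partial>upsilon) \<partial>lborel)"
    by (rule Fubini'[symmetric]) measurable
  also have "\<dots> = (\<integral>\<^sup>+ r. (\<integral>\<^sup>+ z. f z * (indicator A (translate (- r) z) * w (translate (- r) z)) \<partial>upsilon) \<partial>lborel)"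
  proof (rule nn_integral_cong)
    fix r :: real
    \<comment> \<open>Replacing \<open>upsilon\<close> by its image under translation by
      \<open>- r\<close> carries out the substitution; in \<open>f\<close> the two shifts cancel by
      \<open>translate_minus\<close>.\<close>
    have "(\<integral>\<^sup>+ y. f (translate r y) * (indicator A y * w y) \<partial>upsilon)
      = (\<integral>\<^sup>+ y. f (translate r y) * (indicator A y * w y) \<partial>distr upsilon upsilon (translate (- r)))"
      by (simp add: distr_upsilon_translate)
    also have "\<dots> = (\<integral>\<^sup>+ z. f z * (indicator A (translate (- r) z) * w (translate (- r) z)) \<partial>upsilon)"
      by (subst nn_integral_distr) simp_all
    finally show "(\<integral>\<^sup>+ y. f (translate r y) * (indicator A y * w y) \<partial>upsilon) = \<dots>" .
  qed
  also have "\<dots> = (\<integral>\<^sup>+ z. (\<integral>\<^sup>+ r. f z * (indicator A (translate (- r) z) * w (translate (- r) z)) \<partial>lborel) \<partial>upsilon)"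
    by (rule Fubini') measurable
  also have "\<dots> = (\<integral>\<^sup>+ z. f z * (\<integral>\<^sup>+ r. indicator A (translate (- r) z) * w (translate (- r) z) \<partial>lborel) \<partial>upsilon)"
    by (intro nn_integral_cong nn_integral_cmult) measurable
  finally show "emeasure (density upsilon (\<lambda>y. w y * (\<integral>\<^sup>+ r. f (translate r y) \<partial>lborel))) A = \<dots>" .
qed

section \<open>Recentring, and lower sets on the exponential scale\<close>

definition recentre :: "('n::finite \<Rightarrow> ereal) \<Rightarrow> 'n \<Rightarrow> ereal" where
  "recentre x = (\<lambda>j. x j - max_coord x)"

lemma exp_ext_nonneg: "0 \<le> exp_ext x"
  by (simp add: exp_ext_def)

lemma exp_ext_le_1: "x \<le> 0 \<Longrightarrow> exp_ext x \<le> 1"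
  by (cases x) (auto simp: exp_ext_def)

lemma exp_ext_le_exp_iff: "x < \<infinity> \<Longrightarrow> exp_ext x \<le> exp a \<longleftrightarrow> x \<le> ereal a"
  by (cases x) (auto simp: exp_ext_def)

lemma max_coord_finite:
  assumes "x \<in> ext_space" "max_coord x > -\<infinity>"
  obtains m where "max_coord x = ereal m"
proof -
  have "max_coord x \<in> range x" unfolding max_coord_def by (rule Max_in) auto
  then obtain j where "max_coord x = x j" by blast
  then have "max_coord x < \<infinity>" using assms(1) unfolding ext_space_def by simp
  then show thesis using assms(2) that by (cases "max_coord x") auto
qed

text \<open>The target is \<open>borel\<close> rather than \<open>ext_borel\<close>: if all
  coordinates are -\<infinity>, recentring yields \<infinity>.\<close>

lemma measurable_recentre: "T \<in> measurable N ext_borel \<Longrightarrow> (\<lambda>\<omega>. recentre (T \<omega>)) \<in> borel_measurable N"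
  unfolding recentre_def by (intro measurable_coordinatewise_then_product
      borel_measurable_ereal_diff measurable_ext_borel_component measurable_max_coord_ext_borel)

text \<open>The preimage of this box under coordinatewise \<open>exp_ext\<close>, within
  \<open>ext_space\<close>, is \<open>lower_set t\<close>.\<close>

definition exp_box :: "('n::finite \<Rightarrow> real) \<Rightarrow> ('n \<Rightarrow> real) set" where
  "exp_box t = {z. \<forall>j. 0 \<le> z j \<and> z j \<le> exp (t j)}"

lemma exp_box_measurable: "exp_box t \<in> sets borel"
proof -
  have [measurable]: "(\<lambda>z. z j) \<in> borel_measurable (borel :: ('a \<Rightarrow> real) measure)" for j
    by (rule measurable_product_coordinates)
  have "{z \<in> space (borel :: ('a \<Rightarrow> real) measure). \<forall>j. 0 \<le> z j \<and> z j \<le> exp (t j)} \<in> sets borel"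
    by measurable
  then show ?thesis by (simp add: exp_box_def)
qed

text \<open>The unit box contains the origin, so removing the origin from the orthant changes
  nothing here.\<close>

lemma exceed_eq: "exceed = exp_meas_space - exp_box (\<lambda>_. 0)"
  unfolding exceed_def exp_meas_space_def exp_box_def by fastforce

text \<open>Intersecting the box with the unit box gives the box of \<open>min (t j) 0\<close>. The
  difference is written with complements of boxes because the exponent measure is specified on
  those.\<close>

lemma exp_box_Int_exceed:
  "exp_box t \<inter> exceed = (exp_meas_space - exp_box (\<lambda>j. min (t j) 0)) - (exp_meas_space - exp_box t)"
proof -
  have "x \<le> exp (min a 0) \<longleftrightarrow> x \<le> exp a \<and> x \<le> 1" for x a :: real
    by (simp add: min_def not_le) (smt (verit) exp_le_one_iff exp_gt_one)
  then show ?thesis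
    unfolding exceed_def exp_meas_space_def exp_box_def by fastforce
qed

section \<open>The law \<open>GP(G)\<close> in terms of the generator\<close>

locale GP_generator =
  fixes G :: "('n::finite \<Rightarrow> real) measure" and N :: "'b measure" and T :: "'b \<Rightarrow> 'n \<Rightarrow> ereal"
  assumes generator: "T_generator G N T"
begin

sublocale prob_space N
  using generator by (simp add: T_generator_def)

lemma T_measurable [measurable]: "T \<in> measurable N ext_borel"
  using generator by (simp add: T_generator_def)

lemma AE_max_finite: "AE \<omega> in N. \<exists>m. max_coord (T \<omega>) = ereal m"
proof -
  have "AE \<omega> in N. max_coord (T \<omega>) > -\<infinity>" using generator by (simp add: T_generator_def)
  then show ?thesis
  proof (rule AE_mp[OF _ AE_I2], intro impI)
    fix \<omega> assume "\<omega> \<in> space N" "max_coord (T \<omega>) > -\<infinity>"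
    moreover have "T \<omega> \<in> ext_space"
      using measurable_space[OF T_measurable \<open>\<omega> \<in> space N\<close>] by (simp add: space_ext_borel)
    ultimately show "\<exists>m. max_coord (T \<omega>) = ereal m" by (metis max_coord_finite)
  qed
qed

text \<open>The common value of the expectations of exp S_j; \<open>undefined\<close> stands for an
  arbitrary index.\<close>

definition spectral_mean :: real where
  "spectral_mean = (\<integral>\<omega>. exp_ext (recentre (T \<omega>) undefined) \<partial>N)"

definition mean_profile :: "('n \<Rightarrow> real) \<Rightarrow> real" where
  "mean_profile t = (\<integral>\<omega>. profile t (recentre (T \<omega>)) \<partial>N)"

lemma recentre_measurable [measurable]: "(\<lambda>\<omega>. recentre (T \<omega>)) \<in> borel_measurable N"
  by (rule measurable_recentre) measurable

lemma AE_profile_bounds: "AE \<omega> in N. 0 < profile t (recentre (T \<omega>)) \<and>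
    profile t (recentre (T \<omega>)) \<le> Max (range (\<lambda>j. exp (- t j)))"
  using AE_max_finite
proof (rule eventually_mono)
  fix \<omega> assume "\<exists>m. max_coord (T \<omega>) = ereal m"
  then obtain m where m: "max_coord (T \<omega>) = ereal m" ..
  have "exp (- t j) * exp_ext (T \<omega> j - max_coord (T \<omega>)) \<le> Max (range (\<lambda>j. exp (- t j)))" for j
  proof -
    have "exp (- t j) * exp_ext (T \<omega> j - max_coord (T \<omega>)) \<le> exp (- t j)"
      using exp_ext_recentre_le_1[OF m, of j] by (simp add: mult_left_le)
    also have "\<dots> \<le> Max (range (\<lambda>j. exp (- t j)))" by simp
    finally show ?thesis .
  qed
  then show "0 < profile t (recentre (T \<omega>)) \<and> profile t (recentre (T \<omega>)) \<le> Max (range (\<lambda>j. exp (- t j)))"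
    using profile_pos[OF m, of t] unfolding recentre_def profile_le_iff[OF m] by simp
qed

lemma integrable_profile: "integrable N (\<lambda>\<omega>. profile t (recentre (T \<omega>)))"
proof (rule integrable_const_bound)
  show "AE \<omega> in N. norm (profile t (recentre (T \<omega>))) \<le> Max (range (\<lambda>j. exp (- t j)))"
    using AE_profile_bounds[of t] by (rule eventually_mono) simp
qed measurable

lemma mean_profile_pos: "0 < mean_profile t"
  unfolding mean_profile_def
  by (rule expectation_greater[OF integrable_profile])
    (use AE_profile_bounds[of t] in \<open>auto elim: eventually_mono\<close>)

lemma mean_profile_zero: "mean_profile (\<lambda>_. 0) = 1"
proof -
  have "mean_profile (\<lambda>_. 0) = (\<integral>\<omega>. 1 \<partial>N)"
    unfolding mean_profile_def
  proof (rule integral_cong_AE)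
    show "AE \<omega> in N. profile (\<lambda>_. 0) (recentre (T \<omega>)) = 1"
      using AE_max_finite
    proof (rule eventually_mono)
      fix \<omega> assume "\<exists>m. max_coord (T \<omega>) = ereal m"
      then obtain m where m: "max_coord (T \<omega>) = ereal m" ..
      have "profile (\<lambda>_. 0) (recentre (T \<omega>)) \<le> 1"
        unfolding recentre_def profile_le_iff[OF m] using exp_ext_recentre_le_1[OF m] by simp
      \<comment> \<open>With \<open>t = 0\<close> the truncation at 0 does nothing, so
        \<open>profile_min_zero\<close> says that the profile equals the maximum of 1 and
        itself.\<close>
      moreover have "1 \<le> profile (\<lambda>_. 0) (recentre (T \<omega>))"
        using profile_min_zero[OF m, of "\<lambda>_. 0"] by (simp add: recentre_def)
      ultimately show "profile (\<lambda>_. 0) (recentre (T \<omega>)) = 1" by simp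
    qed
  qed measurable
  then show ?thesis by (simp add: prob_space)
qed

lemma AE_profile_min_zero:
  "AE \<omega> in N. profile t (recentre (T \<omega>)) \<le> profile (\<lambda>j. min (t j) 0) (recentre (T \<omega>))"
  using AE_max_finite
proof (rule eventually_mono)
  fix \<omega> assume "\<exists>m. max_coord (T \<omega>) = ereal m"
  then obtain m where m: "max_coord (T \<omega>) = ereal m" ..
  show "profile t (recentre (T \<omega>)) \<le> profile (\<lambda>j. min (t j) 0) (recentre (T \<omega>))"
    unfolding recentre_def profile_min_zero[OF m] by simp
qed

text \<open>\<open>S\<close> and the recentred \<open>T\<close> have the same law, so expectations
  may be computed with either. A zero mean would force a coordinate of \<open>S\<close> to be
  -\<infinity> almost surely, against the definition of a spectral vector.\<close>

lemma spectral_mean_pos: "0 < spectral_mean"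
  and stdf_eq: "stdf G (\<lambda>j. exp (- t j)) = mean_profile t / spectral_mean"
proof -
  from generator obtain N' :: "('n \<Rightarrow> ereal) measure" and S where
    S: "spectral_vector G N' S" and
    "distr N' borel S = distr N borel (\<lambda>\<omega> j. T \<omega> j - max_coord (T \<omega>))"
    unfolding T_generator_def by blast
  then have distr_eq: "distr N' borel S = distr N borel (\<lambda>\<omega>. recentre (T \<omega>))"
    by (simp add: recentre_def)
  interpret N': prob_space N' using S by (simp add: spectral_vector_def)
  have S_range: "S \<in> borel_measurable N' \<and> S \<in> space N' \<rightarrow> {x. \<forall>j. x j \<le> 0}"
    using S unfolding spectral_vector_def measurable_restrict_space2_iff by blast
  then have S_meas: "S \<in> borel_measurable N'" ..
  have S_le: "S \<omega> j \<le> 0" if "\<omega> \<in> space N'" for \<omega> j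
    using S_range that by blast
  note [measurable] = S_meas
  have transfer: "(\<integral>\<omega>. g (S \<omega>) \<partial>N') = (\<integral>\<omega>. g (recentre (T \<omega>)) \<partial>N)"
    if [measurable]: "g \<in> borel_measurable borel" for g :: "('n \<Rightarrow> ereal) \<Rightarrow> real"
    using integral_distr[of S N' borel g] integral_distr[of "\<lambda>\<omega>. recentre (T \<omega>)" N borel g]
    by (simp add: distr_eq)
  have coord [measurable]: "(\<lambda>x. x j) \<in> borel_measurable borel" for j :: 'n
    by (rule measurable_product_coordinates)
  have spectral_mean_eq: "spectral_mean = (\<integral>\<omega>. exp_ext (S \<omega> undefined) \<partial>N')"
    unfolding spectral_mean_def by (rule transfer[symmetric]) measurable
  \<comment> \<open>Without integrability a vanishing integral would say nothing, since the Bochner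
    integral is then 0 by convention.\<close>
  have int: "integrable N' (\<lambda>\<omega>. exp_ext (S \<omega> undefined))"
    by (rule N'.integrable_const_bound[where B = 1])
      (auto simp: exp_ext_nonneg exp_ext_le_1 S_le)
  show "0 < spectral_mean"
  proof (rule ccontr)
    assume "\<not> 0 < spectral_mean"
    moreover have "0 \<le> spectral_mean" unfolding spectral_mean_eq by (simp add: exp_ext_nonneg)
    ultimately have "(\<integral>\<omega>. exp_ext (S \<omega> undefined) \<partial>N') = 0" by (simp add: spectral_mean_eq)
    then have "AE \<omega> in N'. exp_ext (S \<omega> undefined) = 0"
      using integral_nonneg_eq_0_iff_AE[OF int] by (simp add: exp_ext_nonneg)
    then have "AE \<omega> in N'. \<not> S \<omega> undefined > -\<infinity>"
      by (rule eventually_mono) (auto simp: exp_ext_def split: if_splits)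
    then have "measure N' {\<omega> \<in> space N'. S \<omega> undefined > -\<infinity>} = 0"
      by (subst N'.prob_eq_0) auto
    then show False using S unfolding spectral_vector_def by (metis less_irrefl)
  qed
  have "stdf G (\<lambda>j. exp (- t j)) = (\<integral>\<omega>. profile t (S \<omega>) \<partial>N') / (\<integral>\<omega>. exp_ext (S \<omega> undefined) \<partial>N')"
    using S unfolding spectral_vector_def profile_def by simp
  then show "stdf G (\<lambda>j. exp (- t j)) = mean_profile t / spectral_mean"
    by (simp add: spectral_mean_eq mean_profile_def transfer)
qed

text \<open>By definition this measure is minus the logarithm of the Frechet distribution function
  at \<open>exp (t j)\<close>, hence the stable tail dependence function at the reciprocals
  \<open>exp (- t j)\<close>.\<close>

lemma emeasure_exponent_measure:
  assumes "exponent_measure G \<mu>"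
  shows "emeasure \<mu> (exp_meas_space - exp_box t) = ennreal (mean_profile t / spectral_mean)"
proof -
  let ?F = "emeasure \<mu> (exp_meas_space - exp_box t)"
  have "frechet_df G (\<lambda>j. ereal (exp (t j))) = exp_ext (- enn2ereal ?F)"
    using assms unfolding exponent_measure_def exp_box_def by simp
  moreover have "1 / ereal (exp (- t j)) = ereal (exp (t j))" for j
    by (simp add: exp_minus field_simps one_ereal_def)
  ultimately have "mean_profile t / spectral_mean = - ln (exp_ext (- enn2ereal ?F))"
    unfolding stdf_eq[symmetric] stdf_def by simp
  moreover have "0 < mean_profile t / spectral_mean"
    using mean_profile_pos spectral_mean_pos by simp
  \<comment> \<open>If \<open>?F\<close> were infinite, the right-hand side would be \<open>- ln 0\<close>, which is \<open>0\<close> by convention.\<close>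
  ultimately show ?thesis
    by (cases ?F) (auto simp: exp_ext_def)
qed

text \<open>On the exponential scale the lower set is a box, so its probability is a quotient of
  exponent measures in which \<open>spectral_mean\<close> cancels.\<close>

lemma emeasure_GP_lower_set:
  assumes "is_GP G H"
  shows "emeasure H (lower_set t) = (\<integral>\<^sup>+ \<omega>. ennreal
    (profile (\<lambda>j. min (t j) 0) (recentre (T \<omega>)) - profile t (recentre (T \<omega>))) \<partial>N)"
proof -
  from assms obtain \<mu> where H: "sets H = sets ext_borel" and \<mu>: "exponent_measure G \<mu>" and
    GP: "\<And>B. B \<in> sets borel \<Longrightarrow> B \<subseteq> {x. \<forall>j. 0 \<le> x j} \<Longrightarrow>
      emeasure H {y \<in> space H. (\<lambda>j. exp_ext (y j)) \<in> B} = emeasure \<mu> (B \<inter> exceed) / emeasure \<mu> exceed"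
    unfolding is_GP_def by blast
  let ?t0 = "\<lambda>j. min (t j) 0"
  have space: "space H = ext_space"
    using sets_eq_imp_space_eq[OF H] by (simp add: space_ext_borel)
  have eq: "{y \<in> space H. (\<lambda>j. exp_ext (y j)) \<in> exp_box t} = lower_set t"
    by (auto simp: space lower_set_def exp_box_def ext_space_def exp_ext_nonneg exp_ext_le_exp_iff)
  have "exp_box t \<subseteq> {x. \<forall>j. 0 \<le> x j}" by (auto simp: exp_box_def)
  note GP[OF exp_box_measurable this, unfolded eq]
  also have "emeasure \<mu> exceed = ennreal (1 / spectral_mean)"
    by (simp add: exceed_eq emeasure_exponent_measure[OF \<mu>] mean_profile_zero)
  also have "emeasure \<mu> (exp_box t \<inter> exceed)
      = ennreal (mean_profile ?t0 / spectral_mean) - ennreal (mean_profile t / spectral_mean)"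
  proof -
    have "exp_meas_space - exp_box s \<in> sets \<mu>" for s
    proof -
      have "exp_meas_space - exp_box s = exp_meas_space \<inter> - exp_box s" by blast
      moreover have "- exp_box s \<in> sets borel" using exp_box_measurable by (rule borel_comp)
      ultimately show ?thesis
        using \<mu> unfolding exponent_measure_def sets_restrict_space by simp
    qed
    moreover have "exp_box ?t0 \<subseteq> exp_box t"
    proof
      fix z assume z: "z \<in> exp_box ?t0"
      have "exp (min (t j) 0) \<le> exp (t j)" for j by simp
      then show "z \<in> exp_box t"
        using z unfolding exp_box_def by (blast intro: order_trans)
    qed
    then have "exp_meas_space - exp_box t \<subseteq> exp_meas_space - exp_box ?t0" by blast
    ultimately show ?thesis
      \<comment> \<open>Subtraction is legitimate because the exponent measure of the removed set is
        finite.\<close>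
      unfolding exp_box_Int_exceed by (subst emeasure_Diff)
        (simp_all add: emeasure_exponent_measure[OF \<mu>])
  qed
  also have "\<dots> / ennreal (1 / spectral_mean) = ennreal (mean_profile ?t0 - mean_profile t)"
  proof -
    \<comment> \<open>Makes the difference nonnegative, as the passage from division in
      \<open>ennreal\<close> to real division demands.\<close>
    have "mean_profile t \<le> mean_profile ?t0"
      unfolding mean_profile_def
      by (intro integral_mono_AE integrable_profile AE_profile_min_zero)
    then show ?thesis
      using spectral_mean_pos mean_profile_pos[of t]
      by (simp add: ennreal_minus divide_ennreal flip: diff_divide_distrib)
  qed
  also have "\<dots> = (\<integral>\<^sup>+ \<omega>. ennreal (profile ?t0 (recentre (T \<omega>)) - profile t (recentre (T \<omega>))) \<partial>N)"
    unfolding mean_profile_def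
    using AE_profile_min_zero[of t]
    by (subst nn_integral_eq_integral) (auto simp: integrable_profile)
  finally show ?thesis .
qed

end

section \<open>Comparison of the law of \<open>Y\<close> with the candidate density on lower
  sets\<close>

theorem theorem3p10:
  fixes G :: "('n::finite \<Rightarrow> real) measure"
    and H :: "('n \<Rightarrow> ereal) measure"
    and M :: "'a measure" and Y :: "'a \<Rightarrow> 'n \<Rightarrow> ereal"
    and N :: "'b measure" and T :: "'b \<Rightarrow> 'n \<Rightarrow> ereal"
    and f :: "('n \<Rightarrow> ereal) \<Rightarrow> ennreal"
  assumes "mev_distribution G" and "gumbel_margins G" and "is_GP G H"
    and "prob_space M" and "Y \<in> measurable M ext_borel" and "distr M ext_borel Y = H"
    and "T_generator G N T"
    and "distributed N upsilon T f"
  shows "distributed M upsilon Y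
    (\<lambda>y. indicator {y. max_coord y > 0} y * ennreal (exp_ext (- max_coord y)) *
          (\<integral>\<^sup>+ r. f (\<lambda>j. ereal r + y j) \<partial>lborel))"
proof -
  interpret GP_generator G N T by standard (rule assms)
  define w :: "('n \<Rightarrow> ereal) \<Rightarrow> ennreal" where
    "w y = indicator {y. max_coord y > 0} y * ennreal (exp_ext (- max_coord y))" for y
  let ?h = "\<lambda>y. w y * (\<integral>\<^sup>+ r. f (translate r y) \<partial>lborel)"
  have f: "f \<in> borel_measurable upsilon" using assms(8) by (rule distributed_borel_measurable)
  have w: "w \<in> borel_measurable upsilon"
  proof -
    have [measurable]: "max_coord \<in> borel_measurable (ext_borel :: ('n \<Rightarrow> ereal) measure)"
      using measurable_max_coord_ext_borel[of "\<lambda>x. x"] by simp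
    have "indicator {y. max_coord y > 0} y = (if max_coord y > 0 then 1 else 0 :: ennreal)" for y :: "'n \<Rightarrow> ereal"
      by simp
    then show ?thesis unfolding w_def[abs_def] measurable_upsilon_eq by simp
  qed
  note dens = emeasure_density_translates[OF f w]
  have "H = density upsilon ?h"
  proof (rule measure_eqI_lower_set)
    show "finite_measure H" "sets H = sets ext_borel"
      using assms(3) by (auto simp: is_GP_def prob_space_def)
    show "sets (density upsilon ?h) = sets ext_borel" by (simp add: sets_upsilon)
    fix t :: "'n \<Rightarrow> real"
    let ?K = "\<lambda>z. \<integral>\<^sup>+ r. indicator (lower_set t) (translate (- r) z) * w (translate (- r) z) \<partial>lborel"
    have "emeasure H (lower_set t) = (\<integral>\<^sup>+ \<omega>. ennreal
        (profile (\<lambda>j. min (t j) 0) (recentre (T \<omega>)) - profile t (recentre (T \<omega>))) \<partial>N)"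
      by (rule emeasure_GP_lower_set[OF assms(3)])
    \<comment> \<open>Almost surely the maximum of \<open>T\<close> is finite, and the difference of
      profiles is then an integral over translates of \<open>T\<close>.\<close>
    also have "\<dots> = (\<integral>\<^sup>+ \<omega>. ?K (T \<omega>) \<partial>N)"
      using AE_max_finite
      by (intro nn_integral_cong_AE)
        (auto simp: w_def nn_integral_translates recentre_def elim!: eventually_mono)
    \<comment> \<open>The density \<open>f\<close> of \<open>T\<close> enters here, turning the
      expectation into an integral against \<open>upsilon\<close>.\<close>
    also have "\<dots> = (\<integral>\<^sup>+ z. f z * ?K z \<partial>upsilon)"
      by (rule distributed_nn_integral[OF assms(8), symmetric]) (rule dens(2)[OF lower_set_measurable])
    also have "\<dots> = emeasure (density upsilon ?h) (lower_set t)"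
      by (rule dens(3)[OF lower_set_measurable, symmetric])
    finally show "emeasure H (lower_set t) = emeasure (density upsilon ?h) (lower_set t)" .
  qed
  \<comment> \<open>Only the sigma-algebra of the target matters for \<open>distr\<close>, and
    \<open>upsilon\<close> shares it with \<open>ext_borel\<close>.\<close>
  moreover have "distr M upsilon Y = H"
    using assms(6) by (simp add: sets_upsilon cong: distr_cong)
  ultimately have "distributed M upsilon Y ?h"
    using dens(1) assms(5) by (simp add: distributed_def measurable_upsilon_eq)
  then show ?thesis by (simp add: w_def translate_def)
qed

end
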